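(* Let $A$ be a (possibly unbounded) scalar type spectral operator in a complex Banach space. (1) If $F:\sigma(A)\to\mathbb{C}$ is a Borel measurable function, then $$\sigma(F(A))\subseteq\overline{F(\sigma(A))}.$$ (2) If $F:\sigma(A)\to\mathbb{C}$ is a continuous function, then $$\sigma(F(A))=\overline{F(\sigma(A))}.$$
   Context: Spectrum: for a closed linear operator $B$ in a complex Banach space $X$, the resolvent set $\rho(B)$ is the set of $\lambda\in\mathbb{C}$ for which $(B-\lambda I)^{-1}$ exists as a bounded linear operator on all of $X$, and $\sigma(B)=\mathbb{C}\setminus\rho(B)$. Scalar type spectral operator (Dunford, Bade): a densely defined closed linear operator $A$ in $X$ for which there is a (necessarily unique) strongly $\sigma$-additive spectral measure $E_A$ (the resolution of the identity), i.e. a map from the Borel sets of $\mathbb{C}$ to bounded projections on $X$ with $E_A(\emptyset)=0$, $E_A(\mathbb{C})=I$, $E_A(\delta_1\cap\delta_2)=E_A(\delta_1)E_A(\delta_2)$, and $\sigma$-additive in the strong operator topology, such that $A=\int_{\mathbb{C}}\lambda\,dE_A(\lambda)$. The spectrum $\sigma(A)$ is the support of $E_A$: $\sigma(A)$ is closed, $E_A(\mathbb{C}\setminus\sigma(A))=0$, and $E_A(U)\ne0$ for every open $U\subseteq\mathbb{C}$ meeting $\sigma(A)$. Borel operational calculus: for a bounded Borel function $G$ on $\sigma(A)$, $\int_{\sigma(A)} G\,dE_A$ is the operator-norm limit of the integrals of simple Borel functions converging uniformly to $G$. For a Borel measurable $F:\sigma(A)\to\mathbb{C}$, put $e_n=\{\lambda\in\sigma(A):|F(\lambda)|\le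 n\}$; then $F(A)=\int_{\sigma(A)}F(\lambda)\,dE_A(\lambda)$ is the operator with domain consisting of all $f\in X$ for which $\lim_{n\to\infty}\left(\int_{\sigma(A)} F\chi_{e_n}\,dE_A\right)f$ exists, $F(A)f$ being this limit. The integral $A=\int\lambda\,dE_A(\lambda)$ is understood in the same way (with $F(\lambda)=\lambda$). $F(A)$ is again a scalar type spectral operator. The bar denotes closure in $\mathbb{C}$. *)

theory Defs
  imports "HOL-Analysis.Analysis"
begin

section \<open>Complex Banach spaces\<close>

class complex_normed_vector = real_normed_vector +
  fixes scaleC :: "complex \<Rightarrow> 'a \<Rightarrow> 'a" (infixr \<open>*\<^sub>C\<close> 75)
  assumes scaleC_add_right: "a *\<^sub>C (x + y) = a *\<^sub>C x + a *\<^sub>C y"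
    and scaleC_add_left: "(a + b) *\<^sub>C x = a *\<^sub>C x + b *\<^sub>C x"
    and scaleC_scaleC: "a *\<^sub>C b *\<^sub>C x = (a * b) *\<^sub>C x"
    and scaleC_of_real: "complex_of_real r *\<^sub>C x = r *\<^sub>R x"
    and norm_scaleC: "norm (a *\<^sub>C x) = cmod a * norm x"

class complex_banach = complex_normed_vector + banach

lemma scaleC_one [simp]: "1 *\<^sub>C x = (x::'a::complex_normed_vector)"
  using scaleC_of_real[of 1 x] by simp

lemma scaleC_zero_left [simp]: "0 *\<^sub>C x = (0::'a::complex_normed_vector)"
  using scaleC_of_real[of 0 x] by simp

instantiation complex :: complex_banach
begin

definition scaleC_complex :: "complex \<Rightarrow> complex \<Rightarrow> complex"
  where "scaleC_complex a x = a * x"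

instance
  by standard
    (simp_all add: scaleC_complex_def algebra_simps norm_mult scaleR_conv_of_real)

end

lemma bounded_linear_scaleC: "bounded_linear (\<lambda>x::'a::complex_normed_vector. a *\<^sub>C x)"
proof (rule bounded_linear_intro[where K = "cmod a"])
  fix r :: real and x y :: 'a
  show "a *\<^sub>C (x + y) = a *\<^sub>C x + a *\<^sub>C y"
    by (rule scaleC_add_right)
  show "a *\<^sub>C (r *\<^sub>R x) = r *\<^sub>R (a *\<^sub>C x)"
    by (simp add: scaleC_of_real[symmetric] scaleC_scaleC mult.commute)
  show "norm (a *\<^sub>C x) \<le> norm x * cmod a"
    by (simp add: norm_scaleC mult.commute)
qed

instantiation blinfun :: (real_normed_vector, complex_normed_vector) complex_normed_vector
begin

lift_definition scaleC_blinfun :: "complex \<Rightarrow> ('a \<Rightarrow>\<^sub>L 'b) \<Rightarrow> ('a \<Rightarrow>\<^sub>L 'b)"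
  is "\<lambda>a T x. a *\<^sub>C T x"
  by (rule bounded_linear_compose[OF bounded_linear_scaleC])

instance
proof
  fix a b :: complex and r :: real and S T :: "'a \<Rightarrow>\<^sub>L 'b"
  show "a *\<^sub>C (S + T) = a *\<^sub>C S + a *\<^sub>C T"
    by transfer (simp add: scaleC_add_right)
  show "(a + b) *\<^sub>C T = a *\<^sub>C T + b *\<^sub>C T"
    by transfer (simp add: scaleC_add_left)
  show assoc: "a *\<^sub>C b *\<^sub>C T = (a * b) *\<^sub>C T" for a b and T :: "'a \<Rightarrow>\<^sub>L 'b"
    by transfer (simp add: scaleC_scaleC)
  show "complex_of_real r *\<^sub>C T = r *\<^sub>R T"
    by transfer (simp add: scaleC_of_real)
  have le: "norm (a *\<^sub>C T) \<le> cmod a * norm T" for a and T :: "'a \<Rightarrow>\<^sub>L 'b"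
  proof (rule norm_blinfun_bound)
    fix x
    have "norm (blinfun_apply (a *\<^sub>C T) x) = cmod a * norm (blinfun_apply T x)"
      by (simp add: scaleC_blinfun.rep_eq norm_scaleC)
    also have "\<dots> \<le> cmod a * (norm T * norm x)"
      by (intro mult_left_mono norm_blinfun) auto
    finally show "norm (blinfun_apply (a *\<^sub>C T) x) \<le> cmod a * norm T * norm x"
      by (simp add: mult.assoc)
  qed auto
  show "norm (a *\<^sub>C T) = cmod a * norm T"
  proof (cases "a = 0")
    case True
    then show ?thesis using le[of 0 T] by simp
  next
    case False
    have one: "1 *\<^sub>C T = T"
      by transfer simp
    have "norm T = norm (inverse a *\<^sub>C a *\<^sub>C T)"
      using False by (simp add: assoc one)
    also have "\<dots> \<le> cmod (inverse a) * norm (a *\<^sub>C T)"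
      by (rule le)
    finally have "cmod a * norm T \<le> norm (a *\<^sub>C T)"
      using False by (simp add: norm_inverse inverse_eq_divide norm_divide field_simps)
    with le[of a T] show ?thesis by simp
  qed
qed

end

text \<open>The type \<open>'a \<Rightarrow>\<^sub>L 'b\<close> consists of real-linear maps only.\<close>

definition complex_linear :: "('a::complex_normed_vector \<Rightarrow>\<^sub>L 'b::complex_normed_vector) \<Rightarrow> bool"
  where "complex_linear T \<longleftrightarrow> (\<forall>c x. blinfun_apply T (c *\<^sub>C x) = c *\<^sub>C blinfun_apply T x)"

section \<open>Unbounded operators\<close>

text \<open>A partially defined operator is represented by its graph, so that equality of
  operators includes equality of their domains.\<close>

type_synonym 'a operator = "('a \<times> 'a) set"

definition linear_operator :: "'a::complex_normed_vector operator \<Rightarrow> bool"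
  where "linear_operator B \<longleftrightarrow>
    single_valued B \<and> (0, 0) \<in> B \<and>
    (\<forall>x y x' y'. (x, y) \<in> B \<longrightarrow> (x', y') \<in> B \<longrightarrow> (x + x', y + y') \<in> B) \<and>
    (\<forall>c x y. (x, y) \<in> B \<longrightarrow> (c *\<^sub>C x, c *\<^sub>C y) \<in> B)"

definition closed_linear_operator :: "'a::complex_normed_vector operator \<Rightarrow> bool"
  where "closed_linear_operator B \<longleftrightarrow> linear_operator B \<and> closed B"

definition densely_defined :: "'a::complex_normed_vector operator \<Rightarrow> bool"
  where "densely_defined B \<longleftrightarrow> closure (Domain B) = UNIV"

text \<open>The graph of \<open>B - \<mu>I\<close>.\<close>

definition shift_operator :: "'a::complex_normed_vector operator \<Rightarrow> complex \<Rightarrow> 'a operator"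
  where "shift_operator B \<mu> = {(f, g - \<mu> *\<^sub>C f) |f g. (f, g) \<in> B}"

definition resolvent_set :: "'a::complex_normed_vector operator \<Rightarrow> complex set"
  where "resolvent_set B =
    {\<mu>. \<exists>R :: 'a \<Rightarrow>\<^sub>L 'a. complex_linear R \<and>
       (shift_operator B \<mu>)\<inverse> = {(g, blinfun_apply R g) |g. True}}"

definition spectrum :: "'a::complex_normed_vector operator \<Rightarrow> complex set"
  where "spectrum B = - resolvent_set B"

section \<open>Spectral measures and the Borel operational calculus\<close>

text \<open>Only the values of \<open>E\<close> on Borel sets are meaningful.\<close>

definition spectral_measure :: "(complex set \<Rightarrow> 'a::complex_normed_vector \<Rightarrow>\<^sub>L 'a) \<Rightarrow> bool"
  where "spectral_measure E \<longleftrightarrow>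
    (\<forall>\<delta>\<in>sets borel. complex_linear (E \<delta>) \<and> E \<delta> o\<^sub>L E \<delta> = E \<delta>) \<and>
    E {} = 0 \<and> E UNIV = id_blinfun \<and>
    (\<forall>\<delta>\<^sub>1\<in>sets borel. \<forall>\<delta>\<^sub>2\<in>sets borel. E (\<delta>\<^sub>1 \<inter> \<delta>\<^sub>2) = E \<delta>\<^sub>1 o\<^sub>L E \<delta>\<^sub>2) \<and>
    (\<forall>\<delta> :: nat \<Rightarrow> complex set. range \<delta> \<subseteq> sets borel \<longrightarrow> disjoint_family \<delta> \<longrightarrow>
      (\<forall>f. (\<lambda>n. blinfun_apply (E (\<delta> n)) f) sums blinfun_apply (E (\<Union>n. \<delta> n)) f))"

definition simple_integral_op ::
    "(complex set \<Rightarrow> 'a::complex_normed_vector \<Rightarrow>\<^sub>L 'a) \<Rightarrow> complex set \<Rightarrow> (complex \<Rightarrow> complex) \<Rightarrow> 'a \<Rightarrow>\<^sub>L 'a"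
  where "simple_integral_op E S s = (\<Sum>c\<in>s ` S. c *\<^sub>C E {z \<in> S. s z = c})"

text \<open>For a bounded Borel function \<open>G\<close> on a Borel set \<open>S\<close>, the limit exists and is independent
  of the approximating sequence.\<close>

definition bounded_integral_op ::
    "(complex set \<Rightarrow> 'a::complex_normed_vector \<Rightarrow>\<^sub>L 'a) \<Rightarrow> complex set \<Rightarrow> (complex \<Rightarrow> complex) \<Rightarrow> 'a \<Rightarrow>\<^sub>L 'a"
  where "bounded_integral_op E S G =
    (THE T. \<exists>s :: nat \<Rightarrow> complex \<Rightarrow> complex.
       (\<forall>n. simple_function (restrict_space borel S) (s n)) \<and>
       uniform_limit S s G sequentially \<and>
       (\<lambda>n. simple_integral_op E S (s n)) \<longlonglongrightarrow> T)"

text \<open>The integral of a possibly unbounded Borel function \<open>F\<close> over \<open>S\<close>, as a graph.\<close>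

definition spectral_integral ::
    "(complex set \<Rightarrow> 'a::complex_normed_vector \<Rightarrow>\<^sub>L 'a) \<Rightarrow> complex set \<Rightarrow> (complex \<Rightarrow> complex) \<Rightarrow> 'a operator"
  where "spectral_integral E S F =
    {(f, g). (\<lambda>n. blinfun_apply
        (bounded_integral_op E S (\<lambda>z. F z * indicator {w \<in> S. cmod (F w) \<le> real n} z)) f)
      \<longlonglongrightarrow> g}"

definition resolution_of_identity ::
    "'a::complex_normed_vector operator \<Rightarrow> (complex set \<Rightarrow> 'a \<Rightarrow>\<^sub>L 'a) \<Rightarrow> bool"
  where "resolution_of_identity A E \<longleftrightarrow>
    spectral_measure E \<and> A = spectral_integral E UNIV (\<lambda>z. z)"

definition scalar_type_spectral :: "'a::complex_normed_vector operator \<Rightarrow> bool"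
  where "scalar_type_spectral A \<longleftrightarrow>
    closed_linear_operator A \<and> densely_defined A \<and> (\<exists>E. resolution_of_identity A E)"

end

theory Submission imports Defs begin

text \<open>The spectrum of \<open>\<integral> F dE\<close> is the essential range of \<open>F\<close>, that is, the set of all \<open>\<mu>\<close> such that
  no set \<open>{|F - \<mu>| < \<epsilon>}\<close> is \<open>E\<close>-null. If such a set is null, then integrating the bounded function
  \<open>1 / (F - \<mu>)\<close> over its complement gives the resolvent; if none is null, then the ranges of the
  projections \<open>E {|F - \<mu>| < \<epsilon>}\<close> contain approximate eigenvectors. Applied to the identity function,
  this shows that the spectrum of \<open>A\<close> is the support of \<open>E\<close>. Hence the essential range of a Borel
  function on it lies in the closure of its range, with equality for continuous functions.
  The bounded calculus rests on the uniform boundedness of \<open>E\<close>.\<close>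

section \<open>Uniform boundedness for families of operators and for vector measures\<close>

text \<open>By Baire's theorem one of the closed sets \<open>V n\<close> contains a ball around some
  \<open>x\<close>. Subtracting the value at \<open>x\<close> from values elsewhere in the ball
  bounds every member of the family near 0, hence in norm.\<close>

lemma banach_steinhaus:
  fixes \<T> :: "('a::banach \<Rightarrow>\<^sub>L 'b::real_normed_vector) set"
  assumes bdd: "\<And>x. \<exists>K. \<forall>T\<in>\<T>. norm (blinfun_apply T x) \<le> K"
  obtains M where "\<And>T. T \<in> \<T> \<Longrightarrow> norm T \<le> M"
proof -
  define V where "V = (\<lambda>n::nat. {x. \<forall>T\<in>\<T>. norm (blinfun_apply T x) \<le> real n})"
  have V_Inter: "V n = (\<Inter>T\<in>\<T>. {x. norm (blinfun_apply T x) \<le> real n})" for n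
    by (auto simp: V_def)
  have closed_V: "closed (V n)" for n
    unfolding V_Inter by (intro closed_INT ballI closed_Collect_le continuous_intros)
  have "(\<Union>n. V n) = UNIV"
  proof (intro equalityI subset_UNIV subsetI)
    fix x
    obtain K where K: "\<forall>T\<in>\<T>. norm (blinfun_apply T x) \<le> K"
      using bdd by blast
    obtain n where "K \<le> real n"
      using real_arch_simple by blast
    with K have "x \<in> V n"
      by (force simp: V_def)
    then show "x \<in> (\<Union>n. V n)" by blast
  qed
  then have "euclidean interior_of (\<Union>(range V)) \<noteq> ({} :: 'a set)"
    by simp
  then obtain n where "interior (V n) \<noteq> {}"
    using Baire_category_alt[of "euclidean :: 'a topology" "range V"] closed_V
      completely_metrizable_space_euclidean by fastforce
  then obtain x r where r: "0 < r" "ball x r \<subseteq> V n"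
    by (metis all_not_in_conv mem_interior)
  have "norm T \<le> 4 * real n / r" if "T \<in> \<T>" for T
  proof (rule norm_blinfun_bound)
    show "0 \<le> 4 * real n / r" using r by simp
    fix y
    show "norm (blinfun_apply T y) \<le> 4 * real n / r * norm y"
    proof (cases "y = 0")
      case False
      \<comment> \<open>This scaling puts \<open>x + c *\<^sub>R y\<close> at distance
        \<open>r / 2\<close> from \<open>x\<close>, inside the ball.\<close>
      define c where "c = r / (2 * norm y)"
      have c: "0 < c" using r False by (simp add: c_def)
      have "x \<in> V n" "x + c *\<^sub>R y \<in> V n"
        using r False by (auto intro!: subsetD[OF r(2)] simp: dist_norm c_def)
      then have "norm (blinfun_apply T x) \<le> n" "norm (blinfun_apply T (x + c *\<^sub>R y)) \<le> n"
        using that by (auto simp: V_def)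
      then have "norm (blinfun_apply T (x + c *\<^sub>R y) - blinfun_apply T x) \<le> 2 * real n"
        using norm_triangle_ineq4[of "blinfun_apply T (x + c *\<^sub>R y)" "blinfun_apply T x"] by linarith
      then have "c * norm (blinfun_apply T y) \<le> 2 * real n"
        using c by (simp add: blinfun.add_right blinfun.scaleR_right)
      then show ?thesis
        using r False by (simp add: c_def field_simps)
    qed simp
  qed
  with that show thesis by blast
qed

text \<open>An unbounded measure is unbounded on one half of a suitable splitting of any set on which it
  is unbounded, while both halves have large measure; discarding the other half over and over
  yields disjoint sets whose measures do not tend to zero.\<close>

lemma vector_measure_bounded:
  fixes m :: "'b set \<Rightarrow> 'a::real_normed_vector"
  assumes additive: "\<And>A B. A \<in> sets M \<Longrightarrow> B \<in> sets M \<Longrightarrow> A \<inter> B = {} \<Longrightarrow> m (A \<union> B) = m A + m B"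
    and null: "\<And>A :: nat \<Rightarrow> 'b set. range A \<subseteq> sets M \<Longrightarrow> disjoint_family A \<Longrightarrow>
      (\<lambda>n. m (A n)) \<longlonglongrightarrow> 0"
  shows "\<exists>K. \<forall>A\<in>sets M. norm (m A) \<le> K"
proof (rule ccontr)
  define bad where "bad B \<longleftrightarrow> B \<in> sets M \<and> (\<forall>K. \<exists>A\<in>sets M. A \<subseteq> B \<and> K < norm (m A))" for B
  assume unb: "\<not> ?thesis"
  have bad_space: "bad (space M)"
    using unb sets.sets_into_space[of _ M] by (simp add: bad_def not_le)
  have step: "\<exists>B'. bad B' \<and> B' \<subseteq> B \<and> 1 \<le> norm (m (B - B'))" if B: "bad B" for B
  proof -
    \<comment> \<open>Exceeding \<open>norm (m B)\<close> by more than 1 forces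
      \<open>norm (m (B - A))\<close> to be at least 1 as well, so whichever half is discarded later
      has large measure.\<close>
    obtain A where A: "A \<in> sets M" "A \<subseteq> B" "1 + norm (m B) < norm (m A)"
      using B by (auto simp: bad_def)
    have BM: "B \<in> sets M" using B by (simp add: bad_def)
    have split: "m C = m (C \<inter> A) + m (C - A)" if "C \<in> sets M" for C
    proof -
      have "m ((C \<inter> A) \<union> (C - A)) = m (C \<inter> A) + m (C - A)"
        by (rule additive) (use that A in auto)
      moreover have "(C \<inter> A) \<union> (C - A) = C" by blast
      ultimately show ?thesis by simp
    qed
    have "m B = m A + m (B - A)"
      using split[OF BM] A(2) by (simp add: Int_absorb1)
    then have "norm (m A) \<le> norm (m B) + norm (m (B - A))"
      using norm_triangle_ineq4[of "m B" "m (B - A)"] by simp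
    then have big: "1 \<le> norm (m (B - A))" "1 \<le> norm (m A)"
      using A(3) norm_ge_zero[of "m B"] by linarith+
    \<comment> \<open>If \<open>m\<close> were bounded on the subsets of both halves, adding the two
      bounds would bound it on the subsets of \<open>B\<close>.\<close>
    have "bad A \<or> bad (B - A)"
    proof (rule ccontr)
      assume nbad: "\<not> (bad A \<or> bad (B - A))"
      have bdd: "\<exists>K. \<forall>C\<in>sets M. C \<subseteq> D \<longrightarrow> norm (m C) \<le> K" if "D \<in> sets M" "\<not> bad D" for D
        using that unfolding bad_def by (metis not_less)
      obtain K1 where K1: "\<forall>C\<in>sets M. C \<subseteq> A \<longrightarrow> norm (m C) \<le> K1"
        using bdd[of A] nbad A(1) by metis
      obtain K2 where K2: "\<forall>C\<in>sets M. C \<subseteq> B - A \<longrightarrow> norm (m C) \<le> K2"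
        using bdd[of "B - A"] nbad sets.Diff[OF BM A(1)] by metis
      have "norm (m C) \<le> K1 + K2" if C: "C \<in> sets M" "C \<subseteq> B" for C
      proof -
        have "norm (m (C \<inter> A)) \<le> K1"
          using K1 sets.Int[OF C(1) A(1)] by simp
        moreover have "norm (m (C - A)) \<le> K2"
          using K2 sets.Diff[OF C(1) A(1)] Diff_mono[OF C(2) order_refl] by simp
        ultimately show ?thesis
          using split[OF C(1)] norm_triangle_ineq[of "m (C \<inter> A)" "m (C - A)"] by simp
      qed
      moreover obtain C where "C \<in> sets M" "C \<subseteq> B" "K1 + K2 < norm (m C)"
        using B unfolding bad_def by metis
      ultimately show False by (metis not_less)
    qed
    then show ?thesis
    proof
      assume "bad A"
      with big(1) A(2) show ?thesis by blast
    next
      assume "bad (B - A)"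
      moreover have "B - (B - A) = A" using A(2) by blast
      ultimately show ?thesis
        using big(2) by (intro exI[of _ "B - A"]) simp
    qed
  qed
  have "\<exists>B. \<forall>n. bad (B n) \<and> B (Suc n) \<subseteq> B n \<and> 1 \<le> norm (m (B n - B (Suc n)))"
  proof (rule dependent_nat_choice)
    show "\<exists>B. bad B" using bad_space by blast
  qed (rule step)
  then obtain B :: "nat \<Rightarrow> 'b set"
    where B: "\<And>n. bad (B n)" "\<And>n. B (Suc n) \<subseteq> B n \<and> 1 \<le> norm (m (B n - B (Suc n)))"
    by auto
  have anti: "antimono B"
    using B(2) by (simp add: antimono_iff_le_Suc)
  have "disjoint_family (\<lambda>n. B n - B (Suc n))"
    unfolding disjoint_family_on_def
  proof (intro ballI impI)
    fix i j :: nat assume "i \<noteq> j"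
    then consider "Suc i \<le> j" | "Suc j \<le> i" by linarith
    then show "(B i - B (Suc i)) \<inter> (B j - B (Suc j)) = {}"
      by cases (use antimonoD[OF anti] in blast)+
  qed
  then have "(\<lambda>n. m (B n - B (Suc n))) \<longlonglongrightarrow> 0"
    using B(1) by (intro null) (auto simp: bad_def)
  then have "eventually (\<lambda>n. norm (m (B n - B (Suc n))) < 1) sequentially"
    by (auto simp: tendsto_iff dist_norm)
  then show False
    using B(2) by (force simp: eventually_sequentially not_less[symmetric])
qed

section \<open>Norm estimates for finite linear combinations\<close>

text \<open>A sum with coefficients in \<open>[0, 1]\<close> is a convex combination of subset sums; the offset
  \<open>w\<close> makes the induction work.\<close>

lemma norm_sum_convex_le:
  fixes v :: "'i \<Rightarrow> 'a::real_normed_vector"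
  assumes "finite I" "\<And>i. i \<in> I \<Longrightarrow> 0 \<le> a i \<and> a i \<le> 1"
    and "\<And>J. J \<subseteq> I \<Longrightarrow> norm (w + sum v J) \<le> M"
  shows "norm (w + (\<Sum>i\<in>I. a i *\<^sub>R v i)) \<le> M"
  using assms
proof (induction I arbitrary: w rule: finite_induct)
  case empty
  from empty(2)[of "{}"] show ?case by simp
next
  case (insert i I)
  let ?S = "\<Sum>i\<in>I. a i *\<^sub>R v i"
  have a: "0 \<le> a i" "a i \<le> 1"
    using insert.prems(1) by auto
  have 0: "norm (w + ?S) \<le> M"
    by (rule insert.IH) (use insert.prems in auto)
  have 1: "norm (w + v i + ?S) \<le> M"
  proof (rule insert.IH)
    fix J assume "J \<subseteq> I"
    then have "finite J" "i \<notin> J"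
      using insert.hyps finite_subset by auto
    then show "norm (w + v i + sum v J) \<le> M"
      using insert.prems(2)[of "insert i J"] \<open>J \<subseteq> I\<close> by (auto simp: add.assoc)
  qed (use insert.prems in auto)
  \<comment> \<open>The last coefficient interpolates between leaving \<open>v i\<close> out and
    absorbing it into the offset; the induction hypothesis covers both ends.\<close>
  have "w + (\<Sum>i\<in>insert i I. a i *\<^sub>R v i) = (1 - a i) *\<^sub>R (w + ?S) + a i *\<^sub>R (w + v i + ?S)"
    using insert.hyps by (simp add: algebra_simps)
  also have "norm \<dots> \<le> (1 - a i) * norm (w + ?S) + a i * norm (w + v i + ?S)"
    using a by (intro norm_triangle_le) simp
  also have "\<dots> \<le> (1 - a i) * M + a i * M"
    using a 0 1 by (intro add_mono mult_left_mono) auto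
  finally show ?case by (simp add: algebra_simps)
qed

lemma norm_sum_scaleR_le:
  fixes v :: "'i \<Rightarrow> 'a::real_normed_vector"
  assumes "finite I" "\<And>i. i \<in> I \<Longrightarrow> 0 \<le> a i \<and> a i \<le> K" "0 \<le> K"
    and "\<And>J. J \<subseteq> I \<Longrightarrow> norm (sum v J) \<le> M"
  shows "norm (\<Sum>i\<in>I. a i *\<^sub>R v i) \<le> M * K"
proof (cases "K = 0")
  case True
  then have "a i = 0" if "i \<in> I" for i
    using assms(2)[OF that] by simp
  then show ?thesis using True by simp
next
  case False
  then have "K > 0" using assms(3) by simp
  have "norm (0 + (\<Sum>i\<in>I. (a i / K) *\<^sub>R v i)) \<le> M"
    by (rule norm_sum_convex_le) (use assms \<open>K > 0\<close> in auto)
  moreover have "(\<Sum>i\<in>I. a i *\<^sub>R v i) = K *\<^sub>R (\<Sum>i\<in>I. (a i / K) *\<^sub>R v i)"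
    using False by (simp add: scaleR_sum_right)
  ultimately show ?thesis
    using \<open>K > 0\<close> by (simp add: mult.commute)
qed

text \<open>Each coefficient is split into the positive and negative parts of its real and imaginary
  parts. These four nonnegative families, each with values at most \<open>K\<close>, account for the
  factor 4.\<close>

lemma norm_sum_scaleC_le:
  fixes v :: "'i \<Rightarrow> 'a::complex_normed_vector"
  assumes "finite I" "\<And>i. i \<in> I \<Longrightarrow> cmod (c i) \<le> K" "0 \<le> K"
    and "\<And>J. J \<subseteq> I \<Longrightarrow> norm (sum v J) \<le> M"
  shows "norm (\<Sum>i\<in>I. c i *\<^sub>C v i) \<le> 4 * M * K"
proof -
  define S where "S a = (\<Sum>i\<in>I. a (c i) *\<^sub>R v i)" for a :: "complex \<Rightarrow> real"
  have part: "norm (S a) \<le> M * K" if "\<And>z. 0 \<le> a z \<and> a z \<le> cmod z" for a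
    unfolding S_def
    by (rule norm_sum_scaleR_le) (use assms that in \<open>auto intro: order_trans\<close>)
  have parts: "c *\<^sub>C u = max (Re c) 0 *\<^sub>R u - max (- Re c) 0 *\<^sub>R u
      + \<i> *\<^sub>C (max (Im c) 0 *\<^sub>R u - max (- Im c) 0 *\<^sub>R u)" for c and u :: 'a
  proof -
    have "c = of_real (Re c) + \<i> * of_real (Im c)"
      by (simp add: complex_eq)
    then have "c *\<^sub>C u = Re c *\<^sub>R u + \<i> *\<^sub>C Im c *\<^sub>R u"
      by (metis scaleC_add_left scaleC_of_real scaleC_scaleC)
    moreover have "x = max x 0 - max (- x) 0" for x :: real by auto
    ultimately show ?thesis
      by (metis scaleR_left_diff_distrib)
  qed
  have eq: "(\<Sum>i\<in>I. c i *\<^sub>C v i) = S (\<lambda>z. max (Re z) 0) - S (\<lambda>z. max (- Re z) 0)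
      + \<i> *\<^sub>C (S (\<lambda>z. max (Im z) 0) - S (\<lambda>z. max (- Im z) 0))"
    unfolding S_def
    by (subst parts) (simp add: sum.distrib flip: sum_subtractf linear_sum[OF
          bounded_linear.linear[OF bounded_linear_scaleC[of \<i>]]])
  have "norm (\<Sum>i\<in>I. c i *\<^sub>C v i) \<le> norm (S (\<lambda>z. max (Re z) 0)) + norm (S (\<lambda>z. max (- Re z) 0))
      + (norm (S (\<lambda>z. max (Im z) 0)) + norm (S (\<lambda>z. max (- Im z) 0)))"
    unfolding eq by (intro norm_triangle_le add_mono norm_triangle_ineq4)
      (simp add: norm_scaleC norm_triangle_ineq4)
  also have "\<dots> \<le> M * K + M * K + (M * K + M * K)"
    by (intro add_mono part)
      (use abs_Re_le_cmod abs_Im_le_cmod in \<open>auto simp: abs_le_iff\<close>)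
  finally show ?thesis by (simp add: mult.commute)
qed

section \<open>Algebra of bounded operators under complex scalars\<close>

lemma blinfun_compose_scaleC_left: "(c *\<^sub>C S) o\<^sub>L T = c *\<^sub>C (S o\<^sub>L T)"
  by (rule blinfun_eqI) (simp add: scaleC_blinfun.rep_eq)

lemma blinfun_compose_scaleC_right:
  "complex_linear S \<Longrightarrow> S o\<^sub>L (c *\<^sub>C T) = c *\<^sub>C (S o\<^sub>L T)"
  by (rule blinfun_eqI) (simp add: scaleC_blinfun.rep_eq complex_linear_def)

lemma blinfun_compose_id_right: "T o\<^sub>L id_blinfun = T"
  by (rule blinfun_eqI) simp

lemma sum_blinfun_compose_left: "(\<Sum>i\<in>I. S i) o\<^sub>L T = (\<Sum>i\<in>I. S i o\<^sub>L T)"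
  by (rule blinfun_eqI) (simp add: blinfun.sum_left)

lemma sum_blinfun_compose_right: "S o\<^sub>L (\<Sum>i\<in>I. T i) = (\<Sum>i\<in>I. S o\<^sub>L T i)"
  by (rule blinfun_eqI) (simp add: blinfun.sum_left blinfun.sum_right)

lemma scaleC_sum_right: "c *\<^sub>C (\<Sum>i\<in>I. f i) = (\<Sum>i\<in>I. c *\<^sub>C f i)"
  by (rule linear_sum[OF bounded_linear.linear[OF bounded_linear_scaleC]])

lemma scaleC_diff_left: "(a - b) *\<^sub>C x = a *\<^sub>C x - b *\<^sub>C (x :: 'a::complex_normed_vector)"
  using scaleC_add_left[of "a - b" b x] by simp

lemma scaleC_zero_right [simp]: "c *\<^sub>C 0 = (0 :: 'a::complex_normed_vector)"
  using scaleC_add_right[of c 0 0] by simp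

lemma complex_linear_0: "complex_linear 0"
  by (simp add: complex_linear_def)

lemma complex_linear_add: "complex_linear S \<Longrightarrow> complex_linear T \<Longrightarrow> complex_linear (S + T)"
  by (simp add: complex_linear_def blinfun.add_left scaleC_add_right)

lemma complex_linear_scaleC: "complex_linear T \<Longrightarrow> complex_linear (c *\<^sub>C T)"
  by (simp add: complex_linear_def scaleC_blinfun.rep_eq scaleC_scaleC mult.commute)

lemma complex_linear_sum:
  "(\<And>i. i \<in> I \<Longrightarrow> complex_linear (T i)) \<Longrightarrow> complex_linear (\<Sum>i\<in>I. T i)"
  by (induction I rule: infinite_finite_induct) (auto intro: complex_linear_0 complex_linear_add)

lemma tendsto_scaleC: "(f \<longlongrightarrow> l) F \<Longrightarrow> ((\<lambda>x. c *\<^sub>C f x) \<longlongrightarrow> c *\<^sub>C (l :: 'a::complex_normed_vector)) F"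
  by (rule bounded_linear.tendsto[OF bounded_linear_scaleC])

text \<open>Bounded operators here are only real-linear by type, whereas a resolvent must be
  complex-linear; this carries the property from integrals of simple functions to their
  limits.\<close>

lemma complex_linear_LIMSEQ:
  assumes "\<And>n :: nat. complex_linear (T n)" "T \<longlonglongrightarrow> T'"
  shows "complex_linear T'"
  unfolding complex_linear_def
proof (intro allI)
  fix c x
  have lim: "(\<lambda>n. blinfun_apply (T n) y) \<longlonglongrightarrow> blinfun_apply T' y" for y
    using assms(2) by (intro tendsto_intros)
  have "(\<lambda>n. c *\<^sub>C blinfun_apply (T n) x) \<longlonglongrightarrow> blinfun_apply T' (c *\<^sub>C x)"
    using lim[of "c *\<^sub>C x"] assms(1) by (simp add: complex_linear_def)
  then show "blinfun_apply T' (c *\<^sub>C x) = c *\<^sub>C blinfun_apply T' x"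
    using LIMSEQ_unique tendsto_scaleC[OF lim] by blast
qed

text \<open>Real and imaginary parts are rounded down to multiples of \<open>1 / (n + 1)\<close>.
  The bound \<open>K\<close> leaves finitely many multiples, and the error is at most
  \<open>2 / (n + 1)\<close> at every point.\<close>

lemma bounded_measurable_uniform_limit_simple:
  fixes G :: "'b \<Rightarrow> complex"
  assumes G: "G \<in> borel_measurable M" "\<And>z. z \<in> space M \<Longrightarrow> cmod (G z) \<le> K"
  shows "\<exists>s. (\<forall>n. simple_function M (s n)) \<and> uniform_limit (space M) s G sequentially"
proof -
  define q where "q = (\<lambda>(n::nat) (x::real). real_of_int \<lfloor>(real n + 1) * x\<rfloor> / (real n + 1))"
  define s where "s = (\<lambda>n z. Complex (q n (Re (G z))) (q n (Im (G z))))"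
  have q_close: "\<bar>q n x - x\<bar> \<le> 1 / (real n + 1)" for n x
  proof -
    have "q n x - x = (of_int \<lfloor>(real n + 1) * x\<rfloor> - (real n + 1) * x) / (real n + 1)"
      by (simp add: q_def diff_divide_distrib)
    moreover have "\<bar>of_int \<lfloor>(real n + 1) * x\<rfloor> - (real n + 1) * x\<bar> \<le> 1"
      by linarith
    ultimately show ?thesis
      by (simp add: abs_divide divide_right_mono)
  qed
  have q_finite: "finite (q n ` {- K..K})" for n
  proof (rule finite_subset)
    show "q n ` {- K..K} \<subseteq> (\<lambda>i. real_of_int i / (real n + 1)) `
        {\<lfloor>(real n + 1) * (- K)\<rfloor>..\<lfloor>(real n + 1) * K\<rfloor>}"
    proof
      fix y assume "y \<in> q n ` {- K..K}"
      then obtain x where x: "- K \<le> x" "x \<le> K" "y = q n x" by auto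
      have "(real n + 1) * (- K) \<le> (real n + 1) * x" "(real n + 1) * x \<le> (real n + 1) * K"
        using x by (intro mult_left_mono; simp)+
      then have "\<lfloor>(real n + 1) * x\<rfloor> \<in> {\<lfloor>(real n + 1) * (- K)\<rfloor>..\<lfloor>(real n + 1) * K\<rfloor>}"
        by (simp only: atLeastAtMost_iff floor_mono)
      then show "y \<in> (\<lambda>i. real_of_int i / (real n + 1)) `
        {\<lfloor>(real n + 1) * (- K)\<rfloor>..\<lfloor>(real n + 1) * K\<rfloor>}"
        unfolding x(3) q_def by (rule imageI)
    qed
  qed simp
  have "simple_function M (s n)" for n
  proof (rule simple_function_borel_measurable)
    have "(\<lambda>z. q n (Re (G z))) \<in> borel_measurable M" "(\<lambda>z. q n (Im (G z))) \<in> borel_measurable M"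
      unfolding q_def using G(1) by measurable
    then show "s n \<in> borel_measurable M"
      unfolding s_def borel_measurable_complex_iff by simp
    have "s n ` space M \<subseteq> (\<lambda>(x, y). Complex x y) ` (q n ` {- K..K} \<times> q n ` {- K..K})"
    proof
      fix w assume "w \<in> s n ` space M"
      then obtain z where z: "z \<in> space M" "w = s n z" by auto
      have "Re (G z) \<in> {- K..K}" "Im (G z) \<in> {- K..K}"
        using G(2)[OF z(1)] abs_Re_le_cmod[of "G z"] abs_Im_le_cmod[of "G z"] by auto
      then show "w \<in> (\<lambda>(x, y). Complex x y) ` (q n ` {- K..K} \<times> q n ` {- K..K})"
        unfolding z(2) s_def by (intro image_eqI[of _ _ "(q n (Re (G z)), q n (Im (G z)))"]) auto
    qed
    then show "finite (s n ` space M)"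
      by (rule finite_subset) (intro finite_imageI finite_cartesian_product q_finite)
  qed
  moreover have "uniform_limit (space M) s G sequentially"
  proof (rule uniform_limitI)
    fix e :: real assume "0 < e"
    have "(\<lambda>n. 2 / real (Suc n)) \<longlonglongrightarrow> 0"
      by (intro LIMSEQ_Suc lim_const_over_n)
    then have "eventually (\<lambda>n. 2 / real (Suc n) < e) sequentially"
      using \<open>0 < e\<close> by (rule order_tendstoD)
    then show "\<forall>\<^sub>F n in sequentially. \<forall>z\<in>space M. dist (s n z) (G z) < e"
    proof eventually_elim
      case (elim n)
      have "dist (s n z) (G z) < e" for z
      proof -
        have "dist (s n z) (G z) \<le> \<bar>q n (Re (G z)) - Re (G z)\<bar> + \<bar>q n (Im (G z)) - Im (G z)\<bar>"
          using cmod_le[of "s n z - G z"] by (simp add: dist_norm s_def)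
        also have "\<dots> \<le> 1 / (real n + 1) + 1 / (real n + 1)"
          by (intro add_mono q_close)
        also have "\<dots> < e" using elim by (simp add: add.commute)
        finally show ?thesis .
      qed
      then show ?case by blast
    qed
  qed
  ultimately show ?thesis by blast
qed

section \<open>Additivity, continuity and uniform boundedness of a spectral measure\<close>

text \<open>The set \<open>S\<close> is the domain of integration. It is the whole plane when the
  spectrum of the operator itself is located, and that spectrum when functions of the operator are
  studied.\<close>

locale spectral_calculus =
  fixes E :: "complex set \<Rightarrow> 'a::complex_banach \<Rightarrow>\<^sub>L 'a" and S :: "complex set"
  assumes spectral_measure: "spectral_measure E" and S_borel: "S \<in> sets borel"
begin

lemma
  shows E_complex_linear: "A \<in> sets borel \<Longrightarrow> complex_linear (E A)"
    and E_idem: "A \<in> sets borel \<Longrightarrow> E A o\<^sub>L E A = E A"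
    and E_empty: "E {} = 0"
    and E_UNIV: "E UNIV = id_blinfun"
    and E_Int: "A \<in> sets borel \<Longrightarrow> B \<in> sets borel \<Longrightarrow> E (A \<inter> B) = E A o\<^sub>L E B"
    and E_sums: "range D \<subseteq> sets borel \<Longrightarrow> disjoint_family D \<Longrightarrow>
      (\<lambda>n. blinfun_apply (E (D n)) f) sums blinfun_apply (E (\<Union>n::nat. D n)) f"
  using spectral_measure by (auto simp: spectral_measure_def)

text \<open>There is no order on the values of \<open>E\<close>; null sets pass to subsets by
  multiplicativity, since \<open>E A\<close> factors through \<open>E B\<close>.\<close>

lemma E_subset_zero:
  assumes "A \<in> sets borel" "B \<in> sets borel" "A \<subseteq> B" "E B = 0"
  shows "E A = 0"
  using E_Int[of A B] assms by (simp add: Int_absorb2)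

lemma E_Un:
  assumes "A \<in> sets borel" "B \<in> sets borel" "A \<inter> B = {}"
  shows "E (A \<union> B) = E A + E B"
proof (rule blinfun_eqI)
  fix f
  have "(\<lambda>n. blinfun_apply (E (binaryset A B n)) f) sums
      blinfun_apply (E (\<Union>n. binaryset A B n)) f"
    by (rule E_sums) (use assms in \<open>auto simp: range_binaryset_eq disjoint_family_on_def binaryset_def\<close>)
  moreover have "(\<lambda>n. blinfun_apply (E (binaryset A B n)) f) sums
      (\<Sum>n<2. blinfun_apply (E (binaryset A B n)) f)"
    by (rule sums_finite) (auto simp: binaryset_def E_empty)
  moreover have "(\<Sum>n<2. blinfun_apply (E (binaryset A B n)) f) = blinfun_apply (E A + E B) f"
    by (simp add: numeral_2_eq_2 binaryset_def blinfun.add_left)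
  ultimately show "blinfun_apply (E (A \<union> B)) f = blinfun_apply (E A + E B) f"
    using sums_unique2 by (fastforce simp: UN_binaryset_eq)
qed

lemma E_finite_UN:
  assumes "finite I" "\<And>i. i \<in> I \<Longrightarrow> A i \<in> sets borel" "disjoint_family_on A I"
  shows "E (\<Union>i\<in>I. A i) = (\<Sum>i\<in>I. E (A i))"
  using assms
proof (induction I rule: finite_induct)
  case empty
  then show ?case by (simp add: E_empty)
next
  case (insert i I)
  have "E (A i \<union> (\<Union>i\<in>I. A i)) = E (A i) + E (\<Union>i\<in>I. A i)"
    by (rule E_Un) (use insert in \<open>auto simp: disjoint_family_on_def\<close>)
  moreover have "disjoint_family_on A I"
    using insert.prems(2) by (auto simp: disjoint_family_on_def)
  ultimately show ?case
    using insert by simp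
qed

text \<open>Strong countable additivity applied to the successive differences, whose partial sums
  telescope. It later makes the cutoffs of an unbounded function exhaust \<open>S\<close>.\<close>

lemma E_incseq:
  fixes A :: "nat \<Rightarrow> complex set"
  assumes "\<And>n. A n \<in> sets borel" "incseq A"
  shows "(\<lambda>n. blinfun_apply (E (A n)) f) \<longlonglongrightarrow> blinfun_apply (E (\<Union>n. A n)) f"
proof -
  have D: "range (disjointed A) \<subseteq> sets borel"
    using assms(1) by (intro sets.range_disjointed_sets) auto
  \<comment> \<open>The sum up to and including index \<open>n\<close> gives \<open>A n\<close>, so
    the limit is taken along the partial sums shifted by one.\<close>
  have partial: "(\<Sum>k<Suc n. blinfun_apply (E (disjointed A k)) f) = blinfun_apply (E (A n)) f" for n
  proof -
    have "(\<Sum>k<Suc n. E (disjointed A k)) = E (\<Union>k<Suc n. disjointed A k)"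
      by (rule E_finite_UN[symmetric])
        (use D disjoint_family_disjointed[of A] in \<open>auto simp: disjoint_family_on_def\<close>)
    also have "(\<Union>k<Suc n. disjointed A k) = (\<Union>k<Suc n. A k)"
      using finite_UN_disjointed_eq[of A "Suc n"] by (simp add: lessThan_atLeast0)
    also have "\<dots> = A n"
      using assms(2) unfolding incseq_def by (auto simp: less_Suc_eq_le) blast
    finally show ?thesis
      by (metis blinfun.sum_left)
  qed
  have "(\<lambda>n. blinfun_apply (E (disjointed A n)) f) sums blinfun_apply (E (\<Union>n. disjointed A n)) f"
    using D by (intro E_sums disjoint_family_disjointed)
  then show ?thesis
    unfolding sums_def UN_disjointed_eq by (subst (asm) filterlim_sequentially_Suc[symmetric]) (simp only: partial)
qed

lemma E_UN_zero:
  fixes A :: "nat \<Rightarrow> complex set"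
  assumes A: "\<And>n. A n \<in> sets borel" and "\<And>n. E (A n) = 0"
  shows "E (\<Union>n. A n) = 0"
proof (rule blinfun_eqI)
  fix f
  have D: "range (disjointed A) \<subseteq> sets borel"
    using A by (intro sets.range_disjointed_sets) auto
  have "E (disjointed A n) = 0" for n
    by (rule E_subset_zero[OF _ A disjointed_subset]) (use D assms in auto)
  then have "(\<lambda>n. 0) sums blinfun_apply (E (\<Union>n. disjointed A n)) f"
    using E_sums[OF D disjoint_family_disjointed, of f] by simp
  then show "blinfun_apply (E (\<Union>n. A n)) f = blinfun_apply 0 f"
    by (simp add: UN_disjointed_eq sums_iff)
qed

text \<open>Uniform boundedness enters twice. For a fixed vector, the terms of the convergent series
  over disjoint sets tend to 0, so the vector measure is bounded; Banach-Steinhaus then removes the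
  dependence on the vector.\<close>

lemma E_bounded: "\<exists>M. \<forall>A\<in>sets borel. norm (E A) \<le> M"
proof -
  have "\<exists>K. \<forall>A\<in>sets borel. norm (blinfun_apply (E A) x) \<le> K" for x
  proof (rule vector_measure_bounded)
    fix A :: "nat \<Rightarrow> complex set"
    assume "range A \<subseteq> sets borel" "disjoint_family A"
    then show "(\<lambda>n. blinfun_apply (E (A n)) x) \<longlonglongrightarrow> 0"
      using E_sums sums_summable summable_LIMSEQ_zero by blast
  qed (simp add: E_Un blinfun.add_left)
  then have "\<exists>K. \<forall>T\<in>E ` sets borel. norm (blinfun_apply T x) \<le> K" for x
    by simp
  from banach_steinhaus[OF this] show ?thesis
    by (metis imageI)
qed

definition bound :: real
  where "bound = (SOME M. \<forall>A\<in>sets borel. norm (E A) \<le> M)"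

lemma norm_E_le: "A \<in> sets borel \<Longrightarrow> norm (E A) \<le> bound"
  using someI_ex[OF E_bounded] by (simp add: bound_def)

lemma bound_nonneg: "0 \<le> bound"
  using norm_E_le[of "{}"] by (simp add: E_empty)

section \<open>Integrals of simple functions\<close>

abbreviation "bor \<equiv> restrict_space borel S :: complex measure"
abbreviation "simple_int \<equiv> simple_integral_op E S"
abbreviation "bounded_int \<equiv> bounded_integral_op E S"

lemma sets_borD: "A \<in> sets bor \<Longrightarrow> A \<in> sets borel"
  using S_borel by (simp add: sets_restrict_space_iff)

lemma level_set_borel:
  assumes "simple_function bor s"
  shows "{z \<in> S. s z = c} \<in> sets borel"
proof (rule sets_borD)
  have "s -` {c} \<inter> space bor \<in> sets bor"
    using simple_functionD(2)[OF assms] by blast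
  moreover have "s -` {c} \<inter> space bor = {z \<in> S. s z = c}"
    by (auto simp: space_restrict_space)
  ultimately show "{z \<in> S. s z = c} \<in> sets bor" by simp
qed

lemma finite_image_simple: "simple_function bor s \<Longrightarrow> finite (s ` S)"
  using simple_functionD(1) by (force simp: space_restrict_space)

text \<open>Level sets of the composite are finite disjoint unions of level sets of
  \<open>p\<close>, so the sum can be regrouped. The values of \<open>p\<close> may have any type,
  pairs in particular, and surplus elements of \<open>Q\<close> contribute empty level sets.\<close>

lemma simple_int_compose:
  assumes p: "simple_function bor p" and Q: "finite Q" "p ` S \<subseteq> Q"
  shows "simple_int (\<lambda>z. h (p z)) = (\<Sum>q\<in>Q. h q *\<^sub>C E {z \<in> S. p z = q})"
proof -
  have fin: "finite (p ` S)" using p by (rule finite_image_simple)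
  have fibre: "E {z \<in> S. h (p z) = c} = (\<Sum>q | q \<in> p ` S \<and> h q = c. E {z \<in> S. p z = q})" for c
  proof -
    have "{z \<in> S. h (p z) = c} = (\<Union>q\<in>{q \<in> p ` S. h q = c}. {z \<in> S. p z = q})"
      by auto
    then show ?thesis
      using fin by (simp only:, intro E_finite_UN level_set_borel p)
        (auto simp: disjoint_family_on_def)
  qed
  have "simple_int (\<lambda>z. h (p z)) =
      (\<Sum>c\<in>h ` p ` S. \<Sum>q | q \<in> p ` S \<and> h q = c. h q *\<^sub>C E {z \<in> S. p z = q})"
    unfolding simple_integral_op_def fibre scaleC_sum_right
    by (intro sum.cong) auto
  also have "\<dots> = (\<Sum>q\<in>p ` S. h q *\<^sub>C E {z \<in> S. p z = q})"
    using fin by (intro sum.group) auto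
  also have "\<dots> = (\<Sum>q\<in>Q. h q *\<^sub>C E {z \<in> S. p z = q})"
  proof (rule sum.mono_neutral_left[OF Q], intro ballI)
    fix q assume "q \<in> Q - p ` S"
    then have "{z \<in> S. p z = q} = {}" by auto
    then show "h q *\<^sub>C E {z \<in> S. p z = q} = 0" by (simp only: E_empty scaleC_zero_right)
  qed
  finally show ?thesis .
qed

lemma simple_int_complex_linear: "simple_function bor s \<Longrightarrow> complex_linear (simple_int s)"
  unfolding simple_integral_op_def
  by (intro complex_linear_sum complex_linear_scaleC E_complex_linear level_set_borel)

lemma simple_int_indicator:
  assumes "A \<in> sets borel" "A \<subseteq> S"
  shows "simple_int (\<lambda>z. c * indicator A z) = c *\<^sub>C E A"
proof -
  have "A \<in> sets bor"
    using assms S_borel by (simp add: sets_restrict_space_iff)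
  \<comment> \<open>The index set contains both 0 and 1 even if \<open>A\<close> is empty or all of
    \<open>S\<close>, which avoids a case distinction.\<close>
  then have "simple_int (\<lambda>z. c * indicator A z) =
      (\<Sum>q\<in>{0, 1}. (c * q) *\<^sub>C E {z \<in> S. indicator A z = q})"
    by (intro simple_int_compose simple_function_indicator) (auto simp: indicator_def)
  also have "\<dots> = c *\<^sub>C E {z \<in> S. z \<in> A}"
    by (simp add: indicator_def)
  also have "{z \<in> S. z \<in> A} = A" using assms(2) by blast
  finally show ?thesis .
qed

text \<open>A binary pointwise operation on simple functions is evaluated on their common refinement.\<close>

lemma simple_int_pair:
  assumes "simple_function bor s" "simple_function bor t"
  shows "simple_int (\<lambda>z. h (s z) (t z)) =
    (\<Sum>c\<in>s ` S. \<Sum>d\<in>t ` S. h c d *\<^sub>C (E {z \<in> S. s z = c} o\<^sub>L E {z \<in> S. t z = d}))"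
proof -
  have "simple_int (\<lambda>z. h (s z) (t z)) = simple_int (\<lambda>z. (\<lambda>(c, d). h c d) (s z, t z))"
    by simp
  also have "\<dots> = (\<Sum>q\<in>s ` S \<times> t ` S. (\<lambda>(c, d). h c d) q *\<^sub>C E {z \<in> S. (s z, t z) = q})"
    using assms by (intro simple_int_compose simple_function_Pair) (auto intro: finite_image_simple)
  also have "\<dots> = (\<Sum>c\<in>s ` S. \<Sum>d\<in>t ` S. h c d *\<^sub>C E {z \<in> S. (s z, t z) = (c, d)})"
    by (simp add: sum.cartesian_product split_beta prod_eq_iff)
  also have "\<dots> = (\<Sum>c\<in>s ` S. \<Sum>d\<in>t ` S. h c d *\<^sub>C (E {z \<in> S. s z = c} o\<^sub>L E {z \<in> S. t z = d}))"
  proof (intro sum.cong refl)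
    fix c d
    have "{z \<in> S. (s z, t z) = (c, d)} = {z \<in> S. s z = c} \<inter> {z \<in> S. t z = d}"
      by auto
    then show "h c d *\<^sub>C E {z \<in> S. (s z, t z) = (c, d)} =
        h c d *\<^sub>C (E {z \<in> S. s z = c} o\<^sub>L E {z \<in> S. t z = d})"
      by (simp add: E_Int level_set_borel assms)
  qed
  finally show ?thesis .
qed

lemma simple_int_mult:
  assumes "simple_function bor s" "simple_function bor t"
  shows "simple_int (\<lambda>z. s z * t z) = simple_int s o\<^sub>L simple_int t"
proof -
  have "simple_int s o\<^sub>L simple_int t =
      (\<Sum>c\<in>s ` S. \<Sum>d\<in>t ` S. (c * d) *\<^sub>C (E {z \<in> S. s z = c} o\<^sub>L E {z \<in> S. t z = d}))"
    unfolding simple_integral_op_def sum_blinfun_compose_left sum_blinfun_compose_right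
      blinfun_compose_scaleC_left
    by (subst sum.swap) (simp add: blinfun_compose_scaleC_right E_complex_linear level_set_borel assms
        scaleC_scaleC)
  then show ?thesis
    using simple_int_pair[OF assms, of "(*)"] by simp
qed

text \<open>Taking coordinate projections for \<open>h\<close> writes the integrals of
  \<open>s\<close> and \<open>t\<close> over the same refinement as that of the difference, where
  they subtract term by term.\<close>

lemma simple_int_diff:
  assumes "simple_function bor s" "simple_function bor t"
  shows "simple_int (\<lambda>z. s z - t z) = simple_int s - simple_int t"
  using simple_int_pair[OF assms, of "(-)"] simple_int_pair[OF assms, of "\<lambda>c d. c"]
    simple_int_pair[OF assms, of "\<lambda>c d. d"]
  by (simp add: scaleC_diff_left sum_subtractf)

text \<open>The triangle inequality alone would give a bound growing with the number of values.
  Instead, every subsum of the projections is \<open>E\<close> of one Borel set, so it is at most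
  \<open>bound\<close> in norm.\<close>

lemma norm_simple_int_le:
  assumes s: "simple_function bor s" and K: "\<And>z. z \<in> S \<Longrightarrow> cmod (s z) \<le> K" "0 \<le> K"
  shows "norm (simple_int s) \<le> 4 * bound * K"
  unfolding simple_integral_op_def
proof (rule norm_sum_scaleC_le)
  show fin: "finite (s ` S)" using s by (rule finite_image_simple)
  fix J assume "J \<subseteq> s ` S"
  then have "finite J" using fin finite_subset by blast
  have "E (\<Union>c\<in>J. {z \<in> S. s z = c}) = (\<Sum>c\<in>J. E {z \<in> S. s z = c})"
    by (rule E_finite_UN) (auto simp: \<open>finite J\<close> disjoint_family_on_def intro: level_set_borel[OF s])
  then show "norm (\<Sum>c\<in>J. E {z \<in> S. s z = c}) \<le> bound"
    using \<open>finite J\<close> by (metis (mono_tags, lifting) level_set_borel[OF s] norm_E_le sets.finite_UN)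
qed (use K in auto)

section \<open>Integrals of bounded Borel functions\<close>

definition approximates :: "(nat \<Rightarrow> complex \<Rightarrow> complex) \<Rightarrow> (complex \<Rightarrow> complex) \<Rightarrow> bool"
  where "approximates s G \<longleftrightarrow>
    (\<forall>n. simple_function bor (s n)) \<and> uniform_limit S s G sequentially"

text \<open>With two sequences at once, the case of equal sequences gives convergence and the
  general case gives independence of the choice.\<close>

lemma approximates_Cauchy:
  assumes "approximates s G" "approximates t G" "0 < e"
  shows "\<exists>N. \<forall>m\<ge>N. \<forall>n\<ge>N. norm (simple_int (s m) - simple_int (t n)) < e"
proof -
  \<comment> \<open>Both functions are within \<open>d\<close> of \<open>G\<close>, so they differ
    by at most \<open>2 * d\<close> and the integrals by at most \<open>8 * bound * d\<close>; the
    added 1 keeps the quotient meaningful if \<open>bound\<close> is 0 and makes the estimate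
    strict.\<close>
  define d where "d = e / (8 * (bound + 1))"
  have d: "0 < d" using assms(3) bound_nonneg by (simp add: d_def)
  have unif: "uniform_limit S s G sequentially" "uniform_limit S t G sequentially"
    and simple: "\<And>n. simple_function bor (s n)" "\<And>n. simple_function bor (t n)"
    using assms by (auto simp: approximates_def)
  have "\<forall>\<^sub>F n in sequentially. \<forall>z\<in>S. dist (s n z) (G z) < d \<and> dist (t n z) (G z) < d"
    using uniform_limitD[OF unif(1) d] uniform_limitD[OF unif(2) d] by eventually_elim blast
  then obtain N where N: "\<And>n z. N \<le> n \<Longrightarrow> z \<in> S \<Longrightarrow> dist (s n z) (G z) < d \<and> dist (t n z) (G z) < d"
    unfolding eventually_sequentially by blast
  have "norm (simple_int (s m) - simple_int (t n)) < e" if "N \<le> m" "N \<le> n" for m n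
  proof -
    have "norm (simple_int (\<lambda>z. s m z - t n z)) \<le> 4 * bound * (2 * d)"
    proof (rule norm_simple_int_le)
      fix z assume "z \<in> S"
      then have "dist (s m z) (t n z) < d + d"
        using N that by (metis add_strict_mono dist_commute dist_triangle_lt)
      then show "cmod (s m z - t n z) \<le> 2 * d" by (simp add: dist_norm)
    qed (use d simple in \<open>auto intro: simple_function_diff\<close>)
    also have "\<dots> < 8 * (bound + 1) * d" using d by (simp add: algebra_simps)
    also have "\<dots> = e" using bound_nonneg by (simp add: d_def)
    finally show ?thesis by (simp add: simple_int_diff simple)
  qed
  then show ?thesis by blast
qed

text \<open>This justifies the definite description in the definition of the integral: a limit
  exists by completeness, and any two approximating sequences share it.\<close>

lemma bounded_int_LIMSEQ:
  assumes s: "approximates s G"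
  shows "(\<lambda>n. simple_int (s n)) \<longlonglongrightarrow> bounded_int G"
proof -
  let ?P = "\<lambda>T. \<exists>s. (\<forall>n. simple_function bor (s n)) \<and> uniform_limit S s G sequentially \<and>
    (\<lambda>n. simple_int (s n)) \<longlonglongrightarrow> T"
  have "Cauchy (\<lambda>n. simple_int (s n))"
    using approximates_Cauchy[OF s s] by (simp add: Cauchy_def dist_norm)
  then obtain T where T: "(\<lambda>n. simple_int (s n)) \<longlonglongrightarrow> T"
    using Cauchy_convergent convergent_def by blast
  have "T' = T" if "?P T'" for T'
  proof -
    from that obtain t where t: "approximates t G" "(\<lambda>n. simple_int (t n)) \<longlonglongrightarrow> T'"
      by (auto simp: approximates_def)
    have "(\<lambda>n. simple_int (t n) - simple_int (s n)) \<longlonglongrightarrow> 0"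
    proof (rule LIMSEQ_I)
      fix e :: real assume "0 < e"
      then show "\<exists>N. \<forall>n\<ge>N. norm (simple_int (t n) - simple_int (s n) - 0) < e"
        using approximates_Cauchy[OF t(1) s, of e] by auto
    qed
    moreover have "(\<lambda>n. simple_int (t n) - simple_int (s n)) \<longlonglongrightarrow> T' - T"
      by (intro tendsto_diff t T)
    ultimately show "T' = T" using LIMSEQ_unique by fastforce
  qed
  moreover have "?P T" using s T by (auto simp: approximates_def)
  ultimately have "bounded_int G = T"
    unfolding bounded_integral_op_def by (intro the_equality)
  with T show ?thesis by simp
qed

definition bounded_borel :: "(complex \<Rightarrow> complex) \<Rightarrow> bool"
  where "bounded_borel G \<longleftrightarrow> G \<in> borel_measurable bor \<and> (\<exists>K. \<forall>z\<in>S. cmod (G z) \<le> K)"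

lemma bounded_borel_approximates:
  assumes "bounded_borel G"
  obtains s where "approximates s G"
proof -
  from assms obtain K where "\<And>z. z \<in> space bor \<Longrightarrow> cmod (G z) \<le> K"
    by (auto simp: bounded_borel_def space_restrict_space)
  then have "\<exists>s. (\<forall>n. simple_function bor (s n)) \<and> uniform_limit (space bor) s G sequentially"
    using assms by (intro bounded_measurable_uniform_limit_simple) (auto simp: bounded_borel_def)
  with that show thesis
    by (auto simp: approximates_def space_restrict_space)
qed

lemma bounded_borel_bounded_image: "bounded_borel G \<Longrightarrow> bounded (G ` S)"
  by (auto simp: bounded_borel_def bounded_iff)

lemma bounded_borel_diff:
  assumes "bounded_borel G" "bounded_borel H"
  shows "bounded_borel (\<lambda>z. G z - H z)"
proof -
  from assms obtain K L where "\<forall>z\<in>S. cmod (G z) \<le> K" "\<forall>z\<in>S. cmod (H z) \<le> L"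
    by (auto simp: bounded_borel_def)
  then have "cmod (G z - H z) \<le> K + L" if "z \<in> S" for z
    using that by (intro order_trans[OF norm_triangle_ineq4 add_mono]) auto
  with assms show ?thesis
    by (auto simp: bounded_borel_def)
qed

lemma bounded_borel_mult:
  assumes "bounded_borel G" "bounded_borel H"
  shows "bounded_borel (\<lambda>z. G z * H z)"
proof -
  from assms obtain K L where "\<forall>z\<in>S. cmod (G z) \<le> K" "\<forall>z\<in>S. cmod (H z) \<le> L"
    by (auto simp: bounded_borel_def)
  then have "cmod (G z * H z) \<le> K * L" if "z \<in> S" for z
    using that unfolding norm_mult by (intro mult_mono) (auto intro: order_trans[OF norm_ge_zero])
  with assms show ?thesis
    by (auto simp: bounded_borel_def)
qed

lemma simple_function_indicator_borel:
  assumes "A \<in> sets borel" "A \<subseteq> S"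
  shows "simple_function bor (\<lambda>z. c * indicator A z :: complex)"
proof -
  have "A \<in> sets bor" using assms S_borel by (simp add: sets_restrict_space_iff)
  then show ?thesis by (intro simple_function_mult simple_function_indicator) auto
qed

lemma bounded_borel_indicator:
  assumes "A \<in> sets borel" "A \<subseteq> S"
  shows "bounded_borel (\<lambda>z. c * indicator A z)"
proof -
  have "cmod (c * indicator A z) \<le> cmod c" for z
    by (simp add: indicator_def)
  then show ?thesis
    using borel_measurable_simple_function[OF simple_function_indicator_borel[OF assms]]
    by (auto simp: bounded_borel_def)
qed

lemma bounded_int_cong: "(\<And>z. z \<in> S \<Longrightarrow> G z = H z) \<Longrightarrow> bounded_int G = bounded_int H"
  unfolding bounded_integral_op_def by (simp cong: uniform_limit_cong')

lemma bounded_int_indicator: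
  assumes "A \<in> sets borel" "A \<subseteq> S"
  shows "bounded_int (\<lambda>z. c * indicator A z) = c *\<^sub>C E A"
proof -
  have "approximates (\<lambda>_ z. c * indicator A z) (\<lambda>z. c * indicator A z)"
    using assms by (simp add: approximates_def simple_function_indicator_borel uniform_limit_const)
  from bounded_int_LIMSEQ[OF this] show ?thesis
    using assms by (simp add: simple_int_indicator LIMSEQ_const_iff)
qed

lemma bounded_int_complex_linear:
  assumes "bounded_borel G"
  shows "complex_linear (bounded_int G)"
proof -
  obtain s where s: "approximates s G"
    using assms by (rule bounded_borel_approximates)
  then show ?thesis
    by (intro complex_linear_LIMSEQ[OF _ bounded_int_LIMSEQ[OF s]] simple_int_complex_linear)
      (simp add: approximates_def)
qed

lemma bounded_int_diff:
  assumes "bounded_borel G" "bounded_borel H"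
  shows "bounded_int (\<lambda>z. G z - H z) = bounded_int G - bounded_int H"
proof -
  obtain s t where st: "approximates s G" "approximates t H"
    using assms bounded_borel_approximates by metis
  then have "approximates (\<lambda>n z. s n z - t n z) (\<lambda>z. G z - H z)"
    by (auto simp: approximates_def intro: uniform_limit_minus simple_function_diff)
  from bounded_int_LIMSEQ[OF this]
  have "(\<lambda>n. simple_int (s n) - simple_int (t n)) \<longlonglongrightarrow> bounded_int (\<lambda>z. G z - H z)"
    using st by (simp add: approximates_def simple_int_diff)
  moreover have "(\<lambda>n. simple_int (s n) - simple_int (t n)) \<longlonglongrightarrow> bounded_int G - bounded_int H"
    by (intro tendsto_diff bounded_int_LIMSEQ st)
  ultimately show ?thesis by (rule LIMSEQ_unique)
qed

lemma bounded_int_mult: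
  assumes "bounded_borel G" "bounded_borel H"
  shows "bounded_int (\<lambda>z. G z * H z) = bounded_int G o\<^sub>L bounded_int H"
proof -
  obtain s t where st: "approximates s G" "approximates t H"
    using assms bounded_borel_approximates by metis
  then have "approximates (\<lambda>n z. s n z * t n z) (\<lambda>z. G z * H z)"
    using assms by (auto simp: approximates_def
        intro!: uniform_lim_mult bounded_borel_bounded_image simple_function_mult)
  from bounded_int_LIMSEQ[OF this]
  have "(\<lambda>n. simple_int (s n) o\<^sub>L simple_int (t n)) \<longlonglongrightarrow> bounded_int (\<lambda>z. G z * H z)"
    using st by (simp add: approximates_def simple_int_mult)
  moreover have "(\<lambda>n. simple_int (s n) o\<^sub>L simple_int (t n)) \<longlonglongrightarrow> (bounded_int G o\<^sub>L bounded_int H)"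
    by (intro bounded_bilinear.tendsto[OF bounded_bilinear_blinfun_compose] bounded_int_LIMSEQ st)
  ultimately show ?thesis by (rule LIMSEQ_unique)
qed

text \<open>Eventually the approximating simple functions are within \<open>K\<close> of
  \<open>G\<close>, hence bounded by \<open>2 * K\<close>, which doubles the constant 4 of the
  simple case.\<close>

lemma norm_bounded_int_le:
  assumes G: "bounded_borel G" and K: "\<And>z. z \<in> S \<Longrightarrow> cmod (G z) \<le> K" "0 < K"
  shows "norm (bounded_int G) \<le> 8 * bound * K"
proof -
  obtain s where s: "approximates s G"
    using G by (rule bounded_borel_approximates)
  then have "\<forall>\<^sub>F n in sequentially. \<forall>z\<in>S. dist (s n z) (G z) < K"
    using K(2) by (intro uniform_limitD) (auto simp: approximates_def)
  then have "\<forall>\<^sub>F n in sequentially. norm (simple_int (s n)) \<le> 8 * bound * K"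
  proof eventually_elim
    case (elim n)
    have "norm (simple_int (s n)) \<le> 4 * bound * (2 * K)"
    proof (rule norm_simple_int_le)
      show "simple_function bor (s n)" using s by (simp add: approximates_def)
      fix z assume "z \<in> S"
      then have "cmod (s n z) \<le> cmod (G z) + K"
        using elim norm_triangle_ineq2[of "s n z" "G z"] by (force simp: dist_norm)
      with K(1)[OF \<open>z \<in> S\<close>] show "cmod (s n z) \<le> 2 * K" by simp
    qed (use K in simp)
    then show ?case by (simp add: mult.assoc)
  qed
  then show ?thesis
    by (intro Lim_norm_ubound[OF _ bounded_int_LIMSEQ[OF s]]) auto
qed

section \<open>Unbounded Borel functions and the essential range\<close>

lemma vimage_borel:
  assumes "F \<in> borel_measurable bor" "B \<in> sets borel"
  shows "{z \<in> S. F z \<in> B} \<in> sets borel"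
proof (rule sets_borD)
  have "F -` B \<inter> space bor \<in> sets bor" using assms by (rule measurable_sets)
  moreover have "F -` B \<inter> space bor = {z \<in> S. F z \<in> B}"
    by (auto simp: space_restrict_space)
  ultimately show "{z \<in> S. F z \<in> B} \<in> sets bor" by simp
qed

lemma bounded_borel_cutoff:
  assumes F: "F \<in> borel_measurable bor" and A: "A \<in> sets borel" "A \<subseteq> S"
    and K: "\<And>z. z \<in> A \<Longrightarrow> cmod (F z) \<le> K"
  shows "bounded_borel (\<lambda>z. F z * indicator A z)"
proof -
  have "A \<in> sets bor" using A S_borel by (simp add: sets_restrict_space_iff)
  then have "(\<lambda>z. F z * indicator A z) \<in> borel_measurable bor"
    using F by measurable
  moreover have "cmod (F z * indicator A z) \<le> max K 0" for z
    using K by (auto simp: indicator_def le_max_iff_disj)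
  ultimately show ?thesis unfolding bounded_borel_def by blast
qed

lemma bounded_int_commute:
  assumes "bounded_borel G" "bounded_borel H"
  shows "bounded_int G o\<^sub>L bounded_int H = bounded_int H o\<^sub>L bounded_int G"
  using bounded_int_mult[OF assms] bounded_int_mult[OF assms(2,1)] by (simp add: mult.commute)

lemma borel_sublevel: "F \<in> borel_measurable bor \<Longrightarrow> {w \<in> S. cmod (F w) \<le> r} \<in> sets borel"
  using vimage_borel[of F "cball 0 r"] by simp

lemma borel_near: "F \<in> borel_measurable bor \<Longrightarrow> {z \<in> S. dist (F z) \<mu> < \<epsilon>} \<in> sets borel"
  using vimage_borel[of F "ball \<mu> \<epsilon>"] by (simp add: dist_commute)

lemma E_sublevel_LIMSEQ:
  assumes F: "F \<in> borel_measurable bor"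
  shows "(\<lambda>n. blinfun_apply (E {w \<in> S. cmod (F w) \<le> real n}) f) \<longlonglongrightarrow> blinfun_apply (E S) f"
proof -
  have "(\<Union>n. {w \<in> S. cmod (F w) \<le> real n}) = S"
    using real_arch_simple by auto
  moreover have "incseq (\<lambda>n. {w \<in> S. cmod (F w) \<le> real n})"
    by (auto simp: incseq_def)
  ultimately show ?thesis
    using E_incseq[of "\<lambda>n. {w \<in> S. cmod (F w) \<le> real n}" f] borel_sublevel[OF F] by simp
qed

text \<open>Off the null set, \<open>F - \<mu>\<close> is bounded away from 0, so its reciprocal has
  a bounded integral. Multiplicativity on the cutoffs shows that this integral inverts the shifted
  operator from both sides.\<close>

lemma resolvent_setI:
  assumes ES: "E S = id_blinfun" and F: "F \<in> borel_measurable bor"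
    and \<epsilon>: "0 < \<epsilon>" "E {z \<in> S. dist (F z) \<mu> < \<epsilon>} = 0"
  shows "\<mu> \<in> resolvent_set (spectral_integral E S F)"
proof -
  define N where "N = {z \<in> S. dist (F z) \<mu> < \<epsilon>}"
  define D where "D = S - N"
  define C where "C n = {w \<in> S. cmod (F w) \<le> real n}" for n
  define F' where "F' n = (\<lambda>z. F z * indicator (C n) z)" for n
  define H where "H = (\<lambda>z. inverse (F z - \<mu>) * indicator D z)"
  define R where "R = bounded_int H"
  have N: "N \<in> sets borel" unfolding N_def using F by (rule borel_near)
  then have D: "D \<in> sets borel" "D \<subseteq> S" using S_borel by (auto simp: D_def)
  have C: "C n \<in> sets borel" "C n \<subseteq> S" for n
    using borel_sublevel[OF F] by (auto simp: C_def)
  have F': "bounded_borel (F' n)" for n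
    unfolding F'_def by (rule bounded_borel_cutoff[OF F C, of _ "real n"]) (simp add: C_def)
  have H: "bounded_borel H"
    unfolding H_def
  proof (rule bounded_borel_cutoff[OF _ D])
    show "(\<lambda>z. inverse (F z - \<mu>)) \<in> borel_measurable bor" using F by measurable
    fix z assume "z \<in> D"
    then have "\<epsilon> \<le> cmod (F z - \<mu>)" by (auto simp: D_def N_def dist_norm)
    then show "cmod (inverse (F z - \<mu>)) \<le> inverse \<epsilon>"
      using \<epsilon>(1) by (simp add: norm_inverse le_imp_inverse_le)
  qed
  have "E (D \<union> N) = E D + E N"
    using D N by (intro E_Un) (auto simp: D_def)
  moreover have "D \<union> N = S" by (auto simp: D_def N_def)
  ultimately have ED: "E D = id_blinfun"
    using ES \<epsilon>(2) by (simp add: N_def)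
  \<comment> \<open>On \<open>C n\<close>, the product of \<open>F - \<mu>\<close> and
    \<open>H\<close> is the indicator of \<open>D\<close>. Since \<open>E D\<close> is the identity,
    intersecting with \<open>D\<close> does not change the projection.\<close>
  have FR: "bounded_int (F' n) o\<^sub>L R = E (C n) + \<mu> *\<^sub>C (E (C n) o\<^sub>L R)" for n
  proof -
    have I: "bounded_borel (\<lambda>z. \<mu> * indicator (C n) z)"
      using C by (rule bounded_borel_indicator)
    have "(bounded_int (F' n) o\<^sub>L R) - ((\<mu> *\<^sub>C E (C n)) o\<^sub>L R) =
        bounded_int (\<lambda>z. F' n z * H z - (\<mu> * indicator (C n) z) * H z)"
      unfolding R_def by (simp only: bounded_int_diff bounded_int_mult bounded_borel_mult F' H I
          bounded_int_indicator[OF C, symmetric])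
    also have "\<dots> = bounded_int (\<lambda>z. 1 * indicator (C n \<inter> D) z)"
    proof (rule bounded_int_cong)
      fix z
      have "F z - \<mu> \<noteq> 0" if "z \<in> D"
        using that \<epsilon>(1) by (auto simp: D_def N_def)
      then show "F' n z * H z - (\<mu> * indicator (C n) z) * H z = 1 * indicator (C n \<inter> D) z"
        by (auto simp: F'_def H_def indicator_def field_simps)
    qed
    also have "\<dots> = 1 *\<^sub>C E (C n \<inter> D)"
      using C D by (intro bounded_int_indicator) auto
    also have "\<dots> = E (C n)"
      using E_Int[OF C(1) D(1)] by (simp add: ED blinfun_compose_id_right)
    finally show ?thesis
      by (simp add: blinfun_compose_scaleC_left algebra_simps)
  qed
  have C_lim: "(\<lambda>n. blinfun_apply (E (C n)) f) \<longlonglongrightarrow> f" for f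
    using E_sublevel_LIMSEQ[OF F] by (simp add: ES C_def)
  have graph: "(f, g) \<in> spectral_integral E S F \<longleftrightarrow> (\<lambda>n. blinfun_apply (bounded_int (F' n)) f) \<longlonglongrightarrow> g" for f g
    by (simp add: spectral_integral_def F'_def C_def)
  \<comment> \<open>The truncated integrals converge on every vector in the range of
    \<open>R\<close>, so that range lies in the domain of the operator.\<close>
  have lim: "(\<lambda>n. blinfun_apply (bounded_int (F' n) o\<^sub>L R) f) \<longlonglongrightarrow> f + \<mu> *\<^sub>C blinfun_apply R f" for f
    unfolding FR using tendsto_add[OF C_lim[of f] tendsto_scaleC[OF C_lim[of "blinfun_apply R f"]]]
    by (simp add: blinfun.add_left scaleC_blinfun.rep_eq)
  have right_inverse: "(blinfun_apply R g, g + \<mu> *\<^sub>C blinfun_apply R g) \<in> spectral_integral E S F" for g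
    using lim[of g] by (simp add: graph)
  have R_linear: "complex_linear R"
    unfolding R_def using H by (rule bounded_int_complex_linear)
  \<comment> \<open>\<open>R\<close> commutes with each truncated integral, so the limit just
    computed can also be evaluated by applying the bounded \<open>R\<close> last.\<close>
  have left_inverse: "blinfun_apply R (h - \<mu> *\<^sub>C f) = f" if "(f, h) \<in> spectral_integral E S F" for f h
  proof -
    have "(\<lambda>n. blinfun_apply R (blinfun_apply (bounded_int (F' n)) f)) \<longlonglongrightarrow> blinfun_apply R h"
      using that unfolding graph by (intro tendsto_intros)
    then have "(\<lambda>n. blinfun_apply (bounded_int (F' n) o\<^sub>L R) f) \<longlonglongrightarrow> blinfun_apply R h"
      using bounded_int_commute[OF F' H] by (simp add: R_def flip: blinfun_apply_blinfun_compose)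
    then have "blinfun_apply R h = f + \<mu> *\<^sub>C blinfun_apply R f"
      using lim LIMSEQ_unique by blast
    then show ?thesis
      using R_linear by (simp add: blinfun.diff_right complex_linear_def)
  qed
  have "(shift_operator (spectral_integral E S F) \<mu>)\<inverse> = {(g, blinfun_apply R g) |g. True}"
  proof (intro equalityI subrelI)
    fix g f assume "(g, f) \<in> (shift_operator (spectral_integral E S F) \<mu>)\<inverse>"
    then obtain h where "g = h - \<mu> *\<^sub>C f" "(f, h) \<in> spectral_integral E S F"
      by (auto simp: shift_operator_def)
    then show "(g, f) \<in> {(g, blinfun_apply R g) |g. True}"
      using left_inverse by simp
  next
    fix g f assume "(g, f) \<in> {(g, blinfun_apply R g) |g. True}"
    then have "f = blinfun_apply R g" by simp
    then show "(g, f) \<in> (shift_operator (spectral_integral E S F) \<mu>)\<inverse>"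
      using right_inverse[of g] by (force simp: shift_operator_def)
  qed
  with R_linear show ?thesis
    by (auto simp: resolvent_set_def)
qed

text \<open>Vectors in the range of \<open>E {z \<in> S. dist (F z) \<mu> < \<epsilon>}\<close> are approximate eigenvectors.\<close>

lemma approximate_eigenvector:
  assumes F: "F \<in> borel_measurable bor"
    and \<epsilon>: "0 < \<epsilon>" and nz: "E {z \<in> S. dist (F z) \<mu> < \<epsilon>} \<noteq> 0"
  obtains f h where "f \<noteq> 0" "(f, h) \<in> spectral_integral E S F"
    "norm (h - \<mu> *\<^sub>C f) \<le> 8 * bound * \<epsilon> * norm f"
proof -
  define D where "D = {z \<in> S. dist (F z) \<mu> < \<epsilon>}"
  define C where "C n = {w \<in> S. cmod (F w) \<le> real n}" for n
  define F' where "F' n = (\<lambda>z. F z * indicator (C n) z)" for n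
  define T where "T = bounded_int (\<lambda>z. F z * indicator D z)"
  have D: "D \<in> sets borel" "D \<subseteq> S"
    using borel_near[OF F] by (auto simp: D_def)
  have C: "C n \<in> sets borel" "C n \<subseteq> S" for n
    using borel_sublevel[OF F] by (auto simp: C_def)
  have F': "bounded_borel (F' n)" for n
    unfolding F'_def by (rule bounded_borel_cutoff[OF F C, of _ "real n"]) (simp add: C_def)
  have F_near: "cmod (F z) \<le> cmod \<mu> + \<epsilon>" if "z \<in> D" for z
    using that norm_triangle_ineq2[of "F z" \<mu>] by (simp add: D_def dist_norm)
  have FD: "bounded_borel (\<lambda>z. F z * indicator D z)"
    using F D F_near by (rule bounded_borel_cutoff)
  have ind: "bounded_borel (\<lambda>z. c * indicator D z)" for c
    using D by (rule bounded_borel_indicator)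
  obtain x where x: "blinfun_apply (E D) x \<noteq> 0"
    using nz blinfun_eqI[of "E D" 0] by (auto simp: D_def)
  define f where "f = blinfun_apply (E D) x"
  have Df: "blinfun_apply (E D) f = f"
    using E_idem[OF D(1)] by (simp add: f_def flip: blinfun_apply_blinfun_compose)
  \<comment> \<open>\<open>F\<close> is bounded on \<open>D\<close>, so all cutoff sets from
    \<open>n0\<close> on contain \<open>D\<close>. The truncated integrals at \<open>f\<close> are
    then constant, which puts \<open>f\<close> in the domain.\<close>
  obtain n0 where n0: "cmod \<mu> + \<epsilon> \<le> real n0"
    using real_arch_simple by blast
  have "blinfun_apply (bounded_int (F' n)) f = blinfun_apply T f" if "n0 \<le> n" for n
  proof -
    have "bounded_int (F' n) o\<^sub>L E D = bounded_int (\<lambda>z. F' n z * (1 * indicator D z))"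
      using bounded_int_mult[OF F' ind[of 1], of n] bounded_int_indicator[OF D, of 1]
      by (simp only: scaleC_one)
    also have "\<dots> = T"
      unfolding T_def
    proof (rule bounded_int_cong)
      fix z
      have "z \<in> C n" if "z \<in> D"
      proof -
        have "cmod (F z) \<le> real n"
          using F_near[OF that] n0 \<open>n0 \<le> n\<close> by linarith
        then show ?thesis using that D(2) by (auto simp: C_def)
      qed
      then show "F' n z * (1 * indicator D z) = F z * indicator D z"
        by (auto simp: F'_def indicator_def)
    qed
    finally show ?thesis
      by (metis Df blinfun_apply_blinfun_compose)
  qed
  then have "\<forall>\<^sub>F n in sequentially. blinfun_apply T f = blinfun_apply (bounded_int (F' n)) f"
    unfolding eventually_sequentially by metis
  then have "(\<lambda>n. blinfun_apply (bounded_int (F' n)) f) \<longlonglongrightarrow> blinfun_apply T f"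
    by (rule Lim_transform_eventually[OF tendsto_const])
  then have graph: "(f, blinfun_apply T f) \<in> spectral_integral E S F"
    by (simp add: spectral_integral_def F'_def C_def)
  \<comment> \<open>Because \<open>E D\<close> fixes \<open>f\<close>, the residual is the integral
    over \<open>D\<close> of \<open>F - \<mu>\<close>, a function of modulus less than
    \<open>\<epsilon>\<close> there.\<close>
  have "\<mu> *\<^sub>C f = blinfun_apply (\<mu> *\<^sub>C E D) f"
    by (simp add: scaleC_blinfun.rep_eq Df)
  then have "blinfun_apply T f - \<mu> *\<^sub>C f =
      blinfun_apply (bounded_int (\<lambda>z. F z * indicator D z - \<mu> * indicator D z)) f"
    by (simp add: T_def bounded_int_diff FD ind bounded_int_indicator D blinfun.diff_left)
  also have "norm \<dots> \<le> norm (bounded_int (\<lambda>z. F z * indicator D z - \<mu> * indicator D z)) * norm f"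
    by (rule norm_blinfun)
  also have "\<dots> \<le> 8 * bound * \<epsilon> * norm f"
  proof (intro mult_right_mono norm_bounded_int_le bounded_borel_diff FD ind)
    show "cmod (F z * indicator D z - \<mu> * indicator D z) \<le> \<epsilon>" for z
      using \<epsilon> by (auto simp: indicator_def D_def dist_norm)
  qed (use \<epsilon> in auto)
  finally show thesis
    using that graph x by (simp add: f_def)
qed

text \<open>The remaining inclusion holds because a bounded inverse bounds \<open>norm f\<close> by
  a fixed multiple of \<open>norm (h - \<mu> *\<^sub>C f)\<close>, which approximate eigenvectors
  with small \<open>\<epsilon>\<close> violate.\<close>

theorem spectrum_spectral_integral:
  assumes "E S = id_blinfun" "F \<in> borel_measurable bor"
  shows "spectrum (spectral_integral E S F) = {\<mu>. \<forall>\<epsilon>>0. E {z \<in> S. dist (F z) \<mu> < \<epsilon>} \<noteq> 0}"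
proof (intro equalityI subsetI)
  fix \<mu> assume "\<mu> \<in> spectrum (spectral_integral E S F)"
  then show "\<mu> \<in> {\<mu>. \<forall>\<epsilon>>0. E {z \<in> S. dist (F z) \<mu> < \<epsilon>} \<noteq> 0}"
    using resolvent_setI[OF assms] by (auto simp: spectrum_def)
next
  fix \<mu> assume \<mu>: "\<mu> \<in> {\<mu>. \<forall>\<epsilon>>0. E {z \<in> S. dist (F z) \<mu> < \<epsilon>} \<noteq> 0}"
  have False if "\<mu> \<in> resolvent_set (spectral_integral E S F)"
  proof -
    from that obtain R where R: "(shift_operator (spectral_integral E S F) \<mu>)\<inverse> =
        {(g, blinfun_apply R g) |g. True}"
      by (auto simp: resolvent_set_def)
    \<comment> \<open>Chosen so that \<open>norm R * (8 * bound * \<epsilon>) < 1\<close>; the added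
      ones keep the denominator positive.\<close>
    define \<epsilon> where "\<epsilon> = 1 / (8 * (bound + 1) * (norm R + 1))"
    have pos: "0 < 8 * (bound + 1) * (norm R + 1)"
      using bound_nonneg by (intro mult_pos_pos) (auto intro: add_nonneg_pos)
    then have \<epsilon>: "0 < \<epsilon>" by (simp add: \<epsilon>_def)
    obtain f h where f: "f \<noteq> 0" "(f, h) \<in> spectral_integral E S F"
        "norm (h - \<mu> *\<^sub>C f) \<le> 8 * bound * \<epsilon> * norm f"
      using approximate_eigenvector[OF assms(2) \<epsilon>, of \<mu>] \<mu> \<epsilon> by auto
    have "(h - \<mu> *\<^sub>C f, f) \<in> (shift_operator (spectral_integral E S F) \<mu>)\<inverse>"
      using f(2) by (auto simp: shift_operator_def)
    then have "f = blinfun_apply R (h - \<mu> *\<^sub>C f)"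
      unfolding R by simp
    then have "norm f \<le> norm R * norm (h - \<mu> *\<^sub>C f)"
      by (metis norm_blinfun)
    also have "\<dots> \<le> norm R * (8 * bound * \<epsilon> * norm f)"
      by (intro mult_left_mono f) simp
    finally have "1 * norm f \<le> (norm R * (8 * bound * \<epsilon>)) * norm f"
      by (simp add: mult.assoc)
    then have "1 \<le> norm R * (8 * bound * \<epsilon>)"
      using f(1) by (simp only: mult_le_cancel_right) simp
    then have "8 * (bound + 1) * (norm R + 1) \<le> 8 * bound * norm R"
      using pos by (simp add: \<epsilon>_def field_simps)
    then show False
      using bound_nonneg norm_ge_zero[of R] by (simp add: algebra_simps)
  qed
  then show "\<mu> \<in> spectrum (spectral_integral E S F)"
    by (auto simp: spectrum_def)
qed

end

section \<open>The spectrum of the operator as the support of its resolution of the identity\<close>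

text \<open>The complement of the support is null because, by the Lindelof property, countably many null
  balls cover it.\<close>

lemma resolution_of_identity_spectrum:
  fixes A :: "'a::complex_banach operator"
  assumes "resolution_of_identity A E"
  shows "spectrum A = {\<mu>. \<forall>\<epsilon>>0. E (ball \<mu> \<epsilon>) \<noteq> 0}"
    and "spectrum A \<in> sets borel" and "E (spectrum A) = id_blinfun"
proof -
  interpret spectral_calculus E UNIV
    using assms by unfold_locales (auto simp: resolution_of_identity_def)
  have "spectrum (spectral_integral E UNIV (\<lambda>z. z)) =
      {\<mu>. \<forall>\<epsilon>>0. E {z \<in> UNIV. dist z \<mu> < \<epsilon>} \<noteq> 0}"
    by (rule spectrum_spectral_integral) (auto simp: E_UNIV)
  moreover have "{z \<in> UNIV. dist z \<mu> < \<epsilon>} = ball \<mu> \<epsilon>" for \<mu> :: complex and \<epsilon>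
    by (auto simp: dist_commute)
  ultimately show supp: "spectrum A = {\<mu>. \<forall>\<epsilon>>0. E (ball \<mu> \<epsilon>) \<noteq> 0}"
    using assms by (simp add: resolution_of_identity_def)
  define \<F> where "\<F> = {B. \<exists>\<mu> \<epsilon>. B = ball \<mu> \<epsilon> \<and> 0 < \<epsilon> \<and> E (ball \<mu> \<epsilon>) = 0}"
  \<comment> \<open>Not only the centre but every point of a null ball is outside the spectrum,
    since a smaller ball around it is null too. Hence the null balls fill exactly the
    complement.\<close>
  have "\<nu> \<notin> spectrum A" if "\<nu> \<in> ball \<mu> \<epsilon>" "E (ball \<mu> \<epsilon>) = 0" for \<mu> \<nu> \<epsilon>
  proof -
    obtain r where "0 < r" "ball \<nu> r \<subseteq> ball \<mu> \<epsilon>"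
      using open_ball \<open>\<nu> \<in> ball \<mu> \<epsilon>\<close> open_contains_ball by metis
    then show ?thesis
      using E_subset_zero[of "ball \<nu> r" "ball \<mu> \<epsilon>"] that(2) by (auto simp: supp)
  qed
  then have "\<Union>\<F> \<subseteq> - spectrum A"
    unfolding \<F>_def by blast
  moreover have "- spectrum A \<subseteq> \<Union>\<F>"
  proof
    fix \<mu> assume "\<mu> \<in> - spectrum A"
    then obtain \<epsilon> where "0 < \<epsilon>" "E (ball \<mu> \<epsilon>) = 0"
      unfolding supp by blast
    then show "\<mu> \<in> \<Union>\<F>"
      unfolding \<F>_def by (intro UnionI[of "ball \<mu> \<epsilon>"]) auto
  qed
  ultimately have compl: "- spectrum A = \<Union>\<F>"
    by (intro equalityI)
  have "open B" if "B \<in> \<F>" for B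
    using that by (auto simp: \<F>_def)
  then obtain \<G> where \<G>: "\<G> \<subseteq> \<F>" "countable \<G>" "\<Union>\<G> = \<Union>\<F>"
    by (rule Lindelof)
  have open_compl: "open (- spectrum A)"
    unfolding compl by (intro open_Union ballI \<open>\<And>B. B \<in> \<F> \<Longrightarrow> open B\<close>)
  then show borel: "spectrum A \<in> sets borel"
    by (simp add: closed_def)
  \<comment> \<open>The countable subfamily is enumerated as a sequence, which requires it to be
    nonempty; if it is empty, so is the complement.\<close>
  have "E (- spectrum A) = 0"
  proof (cases "\<G> = {}")
    case True
    then show ?thesis by (simp add: compl E_empty flip: \<G>(3))
  next
    case False
    have null: "B \<in> sets borel \<and> E B = 0" if "B \<in> \<F>" for B
      using that by (auto simp: \<F>_def)
    have "from_nat_into \<G> n \<in> \<F>" for n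
      using from_nat_into[OF False] \<G>(1) by blast
    then have "E (\<Union>n. from_nat_into \<G> n) = 0"
      using null by (intro E_UN_zero) blast+
    moreover have "(\<Union>n. from_nat_into \<G> n) = - spectrum A"
      using range_from_nat_into[OF False \<G>(2)] \<G>(3) compl by simp
    ultimately show ?thesis by simp
  qed
  moreover have "E (spectrum A \<union> - spectrum A) = E (spectrum A) + E (- spectrum A)"
    using borel by (intro E_Un) auto
  ultimately show "E (spectrum A) = id_blinfun"
    by (simp add: E_UNIV)
qed

section \<open>The spectral mapping inclusion and equality\<close>

theorem theorem3p2:
  fixes A :: "'a::complex_banach operator"
    and E :: "complex set \<Rightarrow> 'a \<Rightarrow>\<^sub>L 'a"
  assumes "scalar_type_spectral A"
    and "resolution_of_identity A E"
  shows "(\<forall>F. F \<in> borel_measurable (restrict_space borel (spectrum A)) \<longrightarrow>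
            spectrum (spectral_integral E (spectrum A) F) \<subseteq> closure (F ` spectrum A)) \<and>
         (\<forall>F. continuous_on (spectrum A) F \<longrightarrow>
            spectrum (spectral_integral E (spectrum A) F) = closure (F ` spectrum A))"
proof -
  note supp = resolution_of_identity_spectrum[OF assms(2)]
  \<comment> \<open>The calculus is now used over the spectrum. It carries the full measure by
    \<open>supp(3)\<close>, so the essential range description applies.\<close>
  interpret spectral_calculus E "spectrum A"
    using assms(2) supp(2) by unfold_locales (auto simp: resolution_of_identity_def)
  note spectrum_F = spectrum_spectral_integral[OF supp(3)]
  have sub: "spectrum (spectral_integral E (spectrum A) F) \<subseteq> closure (F ` spectrum A)"
    if F: "F \<in> borel_measurable bor" for F
  proof
    fix \<mu> assume \<mu>: "\<mu> \<in> spectrum (spectral_integral E (spectrum A) F)"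
    show "\<mu> \<in> closure (F ` spectrum A)"
      unfolding closure_approachable
    proof (intro allI impI)
      fix \<epsilon> :: real assume "0 < \<epsilon>"
      \<comment> \<open>A set with nonzero projection cannot be empty, so \<open>F\<close> takes a
        value within \<open>\<epsilon>\<close> of \<open>\<mu>\<close>.\<close>
      then have "E {z \<in> spectrum A. dist (F z) \<mu> < \<epsilon>} \<noteq> E {}"
        using \<mu> unfolding spectrum_F[OF F] E_empty by blast
      then have "{z \<in> spectrum A. dist (F z) \<mu> < \<epsilon>} \<noteq> {}"
        by metis
      then show "\<exists>y\<in>F ` spectrum A. dist y \<mu> < \<epsilon>" by blast
    qed
  qed
  have sup: "closure (F ` spectrum A) \<subseteq> spectrum (spectral_integral E (spectrum A) F)"
    if cont: "continuous_on (spectrum A) F" for F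
  proof
    have F: "F \<in> borel_measurable bor"
      using cont by (rule borel_measurable_continuous_on_restrict)
    fix \<mu> assume \<mu>: "\<mu> \<in> closure (F ` spectrum A)"
    have "E {z \<in> spectrum A. dist (F z) \<mu> < \<epsilon>} \<noteq> 0" if "0 < \<epsilon>" for \<epsilon>
    proof
      assume zero: "E {z \<in> spectrum A. dist (F z) \<mu> < \<epsilon>} = 0"
      obtain z where z: "z \<in> spectrum A" "dist (F z) \<mu> < \<epsilon>"
        using \<mu> \<open>0 < \<epsilon>\<close> unfolding closure_approachable by blast
      then have "0 < \<epsilon> - dist (F z) \<mu>" by simp
      then obtain \<delta> where \<delta>: "0 < \<delta>"
        "\<And>w. w \<in> spectrum A \<Longrightarrow> dist w z < \<delta> \<Longrightarrow> dist (F w) (F z) < \<epsilon> - dist (F z) \<mu>"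
        using cont z(1) unfolding continuous_on_iff by metis
      \<comment> \<open>Continuity is used here: near \<open>z\<close> the values of
        \<open>F\<close> stay in the disc around \<open>\<mu>\<close>, so a null preimage of the
        disc would contain a relative neighbourhood of \<open>z\<close>.\<close>
      have "ball z \<delta> \<inter> spectrum A \<subseteq> {z \<in> spectrum A. dist (F z) \<mu> < \<epsilon>}"
      proof
        fix w assume "w \<in> ball z \<delta> \<inter> spectrum A"
        then have "w \<in> spectrum A" "dist (F w) (F z) < \<epsilon> - dist (F z) \<mu>"
          using \<delta>(2) by (auto simp: dist_commute)
        then show "w \<in> {z \<in> spectrum A. dist (F z) \<mu> < \<epsilon>}"
          using dist_triangle[of "F w" \<mu> "F z"] by simp
      qed
      then have "E (ball z \<delta> \<inter> spectrum A) = 0"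
        by (rule E_subset_zero[OF sets.Int[OF borel_open[OF open_ball] supp(2)]
              borel_near[OF F] _ zero])
      \<comment> \<open>Full measure of the spectrum upgrades the null relative ball to a null ball,
        contradicting that \<open>z\<close> lies in the support.\<close>
      then have "E (ball z \<delta>) = 0"
        using E_Int[of "ball z \<delta>" "spectrum A"] supp(2,3)
        by (simp add: blinfun_compose_id_right)
      with z(1) \<delta>(1) show False unfolding supp(1) by blast
    qed
    then show "\<mu> \<in> spectrum (spectral_integral E (spectrum A) F)"
      unfolding spectrum_F[OF F] by blast
  qed
  have "spectrum (spectral_integral E (spectrum A) F) = closure (F ` spectrum A)"
    if "continuous_on (spectrum A) F" for F
    using sub[OF borel_measurable_continuous_on_restrict[OF that]] sup[OF that] by (rule equalityI)
  with sub show ?thesis by blast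
qed

end
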